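(* Let $\mathcal{D}$ be a cylindrical algebraic decomposition of $\mathbb{R}^n$ compatible with a semialgebraic set $S\subset\mathbb{R}^n$ and satisfying the frontier condition. Then, for all $1\le k<n$, the decomposition induced by $\mathcal{D}$ on $\mathbb{R}^k$ is a cylindrical decomposition of $\mathbb{R}^k$ compatible with $\mathrm{proj}_{\mathbb{R}^k}(S)$ and satisfying the frontier condition.
   Context: $\mathrm{proj}_{\mathbb{R}^k}:\mathbb{R}^n\to\mathbb{R}^k$ is the projection to the first $k$ coordinates. **Cylindrical cells.** Let $n\ge 1$ and $(i_1,\ldots,i_n)\in\{0,1\}^n$. A cylindrical $(i_1,\ldots,i_n)$-cell is a semialgebraic set in $\mathbb{R}^n$ defined by induction on $n$. - $n=1$: a $(0)$-cell is a single point $x\in\mathbb{R}$; a $(1)$-cell is an open interval $(x,y)$, $(-\infty,y)$, $(x,\infty)$ or $(-\infty,\infty)$, with $x,y\in\mathbb{R}$. - $n>1$: an $(i_1,\ldots,i_{n-1},0)$-cell (section cell) is the graph in $\mathbb{R}^n$ of a continuous semialgebraic function $f:C'\to\mathbb{R}$, where $C'$ is an $(i_1,\ldots,i_{n-1})$-cell. An $(i_1,\ldots,i_{n-1},1)$-cell (sector cell) is a subset of $C'\times\mathbb{R}$ of one of the forms $\{(x,t): f(x)<t<g(x)\}$, $\{(x,t): f(x)<t\}$, $\{(x,t): t<g(x)\}$, or $C'\times\mathbb{R}$, where $C'$ is an $(i_1,\ldots,i_{n-1})$-cell and $f,g:C'\to\mathbb{R}$ are continuous semialgebraic functions such that $f(x)<g(x)$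 for all $x\in C'$. **Cylindrical (algebraic) decomposition (CAD) and induced decompositions.** A cylindrical decomposition of $\mathbb{R}^n$ is a finite partition of $\mathbb{R}^n$ into cylindrical cells, defined by induction on $n$. For $n=0$ it consists of a single point. For $n>0$, given a partition $\mathcal{D}$ of $\mathbb{R}^n$ into (finitely many) cylindrical cells, let $\mathcal{D}'$ be the set of all cells $C'\subset\mathbb{R}^{n-1}$ with $C'=\mathrm{proj}_{\mathbb{R}^{n-1}}(C)$ for some cell $C$ of $\mathcal{D}$. Then $\mathcal{D}$ is a cylindrical decomposition of $\mathbb{R}^n$ if $\mathcal{D}'$ is a cylindrical decomposition of $\mathbb{R}^{n-1}$; in this case $\mathcal{D}'$ is called the decomposition of $\mathbb{R}^{n-1}$ induced by $\mathcal{D}$. The decomposition induced on $\mathbb{R}^k$ is obtained by iterating this operation. **Compatibility.** A cylindrical decomposition is compatible with a semialgebraic set $X$ if for every cell $C$ either $C\subset X$ or $C\cap X=\emptyset$. **Frontier condition.** A decomposition satisfies the frontier condition if for each of its cells $C$ the frontier $\mathrm{cl}(C)\setminus C$ (Euclidean closure) is a union of cells of the decomposition. *)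

theory Defs
  imports "HOL-Analysis.Analysis" "HOL-Library.Disjoint_Sets"
begin

text \<open>
  The space \<open>\<real>\<^sup>n\<close> is the library topology \<^const>\<open>Euclidean_space\<close> \<open>n\<close>: its points are the
  functions \<open>nat \<Rightarrow> real\<close> that vanish at all indices \<open>i \<ge> n\<close>, so the coordinates are numbered
  from 0, and \<open>\<real>\<^sup>0\<close> is a single point. For a point \<open>x\<close> of \<open>\<real>\<^sup>n\<close> and a real \<open>t\<close>, the point
  \<open>(x, t)\<close> of \<open>\<real>\<^sup>n\<^sup>+\<^sup>1\<close> is \<open>x(n := t)\<close>.
\<close>

abbreviation RR :: "nat \<Rightarrow> (nat \<Rightarrow> real) set"
  where "RR n \<equiv> topspace (Euclidean_space n)"

definition proj :: "nat \<Rightarrow> (nat \<Rightarrow> real) \<Rightarrow> (nat \<Rightarrow> real)"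
  where "proj k x = (\<lambda>i. if i < k then x i else 0)"


subsection \<open>Semialgebraic sets and functions\<close>

inductive polynomial_fun :: "nat \<Rightarrow> ((nat \<Rightarrow> real) \<Rightarrow> real) \<Rightarrow> bool" for n
  where
    const: "polynomial_fun n (\<lambda>x. c)"
  | coord: "i < n \<Longrightarrow> polynomial_fun n (\<lambda>x. x i)"
  | add: "polynomial_fun n p \<Longrightarrow> polynomial_fun n q \<Longrightarrow> polynomial_fun n (\<lambda>x. p x + q x)"
  | mult: "polynomial_fun n p \<Longrightarrow> polynomial_fun n q \<Longrightarrow> polynomial_fun n (\<lambda>x. p x * q x)"

inductive semialgebraic :: "nat \<Rightarrow> (nat \<Rightarrow> real) set \<Rightarrow> bool" for n
  where
    pos: "polynomial_fun n p \<Longrightarrow> semialgebraic n {x \<in> RR n. p x > 0}"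
  | compl: "semialgebraic n A \<Longrightarrow> semialgebraic n (RR n - A)"
  | union: "semialgebraic n A \<Longrightarrow> semialgebraic n B \<Longrightarrow> semialgebraic n (A \<union> B)"
  | inter: "semialgebraic n A \<Longrightarrow> semialgebraic n B \<Longrightarrow> semialgebraic n (A \<inter> B)"

definition graph_over :: "nat \<Rightarrow> (nat \<Rightarrow> real) set \<Rightarrow> ((nat \<Rightarrow> real) \<Rightarrow> real) \<Rightarrow> (nat \<Rightarrow> real) set"
  where "graph_over n C f = {x(n := f x) | x. x \<in> C}"

text \<open>Only the values of \<open>f\<close> on \<open>C\<close> matter here.\<close>

definition cont_semialgebraic_on ::
    "nat \<Rightarrow> (nat \<Rightarrow> real) set \<Rightarrow> ((nat \<Rightarrow> real) \<Rightarrow> real) \<Rightarrow> bool"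
  where "cont_semialgebraic_on n C f \<longleftrightarrow>
    continuous_map (subtopology (Euclidean_space n) C) euclideanreal f \<and>
    semialgebraic (Suc n) (graph_over n C f)"


subsection \<open>Cylindrical cells\<close>

text \<open>
  \<open>cylindrical_cell [i\<^sub>1, \<dots>, i\<^sub>n] C\<close> means that \<open>C\<close> is an \<open>(i\<^sub>1, \<dots>, i\<^sub>n)\<close>-cell in \<open>\<real>\<^sup>n\<close>. The rule
  \<open>origin\<close> only serves the decomposition of \<open>\<real>\<^sup>0\<close>; it is not used to build the cells of
  \<open>\<real>\<^sup>n\<close> for \<open>n \<ge> 1\<close>.
\<close>

inductive cylindrical_cell :: "nat list \<Rightarrow> (nat \<Rightarrow> real) set \<Rightarrow> bool"
  where
    origin: "cylindrical_cell [] {\<lambda>_. 0}"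
  | point: "cylindrical_cell [0] {(\<lambda>_. 0)(0 := a)}"
  | interval: "a < b \<Longrightarrow> cylindrical_cell [1] {(\<lambda>_. 0)(0 := t) | t. a < t \<and> t < b}"
  | interval_above: "cylindrical_cell [1] {(\<lambda>_. 0)(0 := t) | t. a < t}"
  | interval_below: "cylindrical_cell [1] {(\<lambda>_. 0)(0 := t) | t. t < b}"
  | line: "cylindrical_cell [1] {(\<lambda>_. 0)(0 := t) | t. True}"
  | section_cell: "cylindrical_cell js C' \<Longrightarrow> n = length js \<Longrightarrow> n \<ge> 1 \<Longrightarrow>
      cont_semialgebraic_on n C' f \<Longrightarrow>
      cylindrical_cell (js @ [0]) (graph_over n C' f)"
  | sector: "cylindrical_cell js C' \<Longrightarrow> n = length js \<Longrightarrow> n \<ge> 1 \<Longrightarrow>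
      cont_semialgebraic_on n C' f \<Longrightarrow> cont_semialgebraic_on n C' g \<Longrightarrow>
      (\<forall>x \<in> C'. f x < g x) \<Longrightarrow>
      cylindrical_cell (js @ [1]) {x(n := t) | x t. x \<in> C' \<and> f x < t \<and> t < g x}"
  | sector_above: "cylindrical_cell js C' \<Longrightarrow> n = length js \<Longrightarrow> n \<ge> 1 \<Longrightarrow>
      cont_semialgebraic_on n C' f \<Longrightarrow>
      cylindrical_cell (js @ [1]) {x(n := t) | x t. x \<in> C' \<and> f x < t}"
  | sector_below: "cylindrical_cell js C' \<Longrightarrow> n = length js \<Longrightarrow> n \<ge> 1 \<Longrightarrow>
      cont_semialgebraic_on n C' g \<Longrightarrow>
      cylindrical_cell (js @ [1]) {x(n := t) | x t. x \<in> C' \<and> t < g x}"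
  | cylinder: "cylindrical_cell js C' \<Longrightarrow> n = length js \<Longrightarrow> n \<ge> 1 \<Longrightarrow>
      cylindrical_cell (js @ [1]) {x(n := t) | x t. x \<in> C'}"

definition is_cell :: "nat \<Rightarrow> (nat \<Rightarrow> real) set \<Rightarrow> bool"
  where "is_cell n C \<longleftrightarrow> (\<exists>js. length js = n \<and> cylindrical_cell js C)"


subsection \<open>Cylindrical decompositions\<close>

definition induced_step :: "nat \<Rightarrow> (nat \<Rightarrow> real) set set \<Rightarrow> (nat \<Rightarrow> real) set set"
  where "induced_step m D = {C'. is_cell m C' \<and> (\<exists>C \<in> D. C' = proj m ` C)}"

fun cylindrical_decomposition :: "nat \<Rightarrow> (nat \<Rightarrow> real) set set \<Rightarrow> bool"
  where
    "cylindrical_decomposition 0 D \<longleftrightarrow> D = {RR 0}"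
  | "cylindrical_decomposition (Suc m) D \<longleftrightarrow>
      finite D \<and> partition_on (RR (Suc m)) D \<and> (\<forall>C \<in> D. is_cell (Suc m) C) \<and>
      cylindrical_decomposition m (induced_step m D)"

text \<open>
  \<open>induced_decomposition k n D\<close> is the decomposition of \<open>\<real>\<^sup>k\<close> induced by a decomposition \<open>D\<close> of
  \<open>\<real>\<^sup>n\<close>, for \<open>k \<le> n\<close>, obtained by descending through \<open>\<real>\<^sup>n\<^sup>-\<^sup>1\<close>, \<open>\<real>\<^sup>n\<^sup>-\<^sup>2\<close>, \<open>\<dots>\<close>, \<open>\<real>\<^sup>k\<close>.
\<close>

fun induced_decomposition ::
    "nat \<Rightarrow> nat \<Rightarrow> (nat \<Rightarrow> real) set set \<Rightarrow> (nat \<Rightarrow> real) set set"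
  where
    "induced_decomposition k 0 D = D"
  | "induced_decomposition k (Suc m) D =
      (if k \<le> m then induced_decomposition k m (induced_step m D) else D)"

definition compatible :: "(nat \<Rightarrow> real) set set \<Rightarrow> (nat \<Rightarrow> real) set \<Rightarrow> bool"
  where "compatible D X \<longleftrightarrow> (\<forall>C \<in> D. C \<subseteq> X \<or> C \<inter> X = {})"

text \<open>
  The frontier is \<open>cl(C) - C\<close>, which differs from the library's \<^const>\<open>frontier_of\<close>
  (closure minus interior).
\<close>

definition frontier_condition :: "nat \<Rightarrow> (nat \<Rightarrow> real) set set \<Rightarrow> bool"
  where "frontier_condition n D \<longleftrightarrow>
    (\<forall>C \<in> D. \<exists>E \<subseteq> D. (Euclidean_space n closure_of C) - C = \<Union>E)"

end

theory Submission imports Defs begin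

text \<open>
  Everything reduces to one descent from \<open>\<real>\<^sup>m\<^sup>+\<^sup>1\<close> to \<open>\<real>\<^sup>m\<close> with \<open>m \<ge> 1\<close>, which is then iterated.
  Let \<open>D'\<close> be the decomposition that \<open>D\<close> induces on \<open>\<real>\<^sup>m\<close>. Every cell of \<open>D\<close> projects onto a cell,
  namely its base (\<open>is_cell_proj\<close>), so every cell of \<open>D\<close> lies over exactly one cell of \<open>D'\<close>, and the cells of \<open>D\<close>
  lying over \<open>C' \<in> D'\<close> cover \<open>C' \<times> \<real>\<close>.

  Compatibility: if \<open>C' \<in> D'\<close> meets the projection of \<open>S\<close>, then the cell of \<open>D\<close> through a
  point of \<open>S\<close> over \<open>C'\<close> is contained in \<open>S\<close> and projects onto all of \<open>C'\<close>.

  Frontier condition: let \<open>x\<close> lie in the closure of \<open>C'\<close> but in another cell \<open>B'\<close>. The point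
  \<open>(x, 0)\<close> lies in the closure of \<open>C' \<times> {0}\<close>, which is covered by the finitely many cells over \<open>C'\<close>;
  a finite union commutes with closure, so \<open>(x, 0)\<close> lies in the closure of a single cell \<open>C\<close> over
  \<open>C'\<close>. The cell \<open>B\<close> through \<open>(x, 0)\<close> lies over \<open>B'\<close>, hence differs from \<open>C\<close>, and the frontier
  condition for \<open>D\<close> puts all of \<open>B\<close> into the closure of \<open>C\<close>. Projecting, \<open>B'\<close> is contained in the
  closure of \<open>C'\<close>; this is \<open>induced_step_closure\<close>. Finiteness of \<open>D\<close> is what guarantees that
  some cell over \<open>C'\<close> reaches the vertical line over \<open>x\<close>; a single section over \<open>C'\<close> may well
  escape to infinity there.
\<close>

lemma RR_eq: "RR n = {x. \<forall>i\<ge>n. x i = 0}"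
  by (rule topspace_Euclidean_space)

lemma proj_id: "x \<in> RR n \<Longrightarrow> proj n x = x"
  by (auto simp: RR_eq proj_def fun_eq_iff)

lemma proj_in_RR: "proj n x \<in> RR n"
  by (auto simp: RR_eq proj_def)

lemma proj_update: "x \<in> RR n \<Longrightarrow> proj n (x(n := t)) = x"
  by (auto simp: RR_eq proj_def fun_eq_iff)

lemma proj_image_proj: "k \<le> m \<Longrightarrow> proj k ` proj m ` S = proj k ` S"
  unfolding image_image by (intro image_cong) (auto simp: proj_def fun_eq_iff)

lemma RR_mono: "x \<in> RR m \<Longrightarrow> m \<le> n \<Longrightarrow> x \<in> RR n"
  by (auto simp: RR_eq)

lemma closure_of_Euclidean_space_mono:
  assumes "m \<le> n"
  shows "Euclidean_space m closure_of A \<subseteq> Euclidean_space n closure_of A"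
proof -
  have "continuous_map (Euclidean_space m) (Euclidean_space n) (\<lambda>x. x)"
    using assms
    by (auto simp: Euclidean_space_def continuous_map_in_subtopology
        intro!: continuous_map_from_subtopology)
  from continuous_map_image_closure_subset[OF this, of A] show ?thesis by simp
qed

lemma proj_closure_of_subset:
  "proj m ` (Euclidean_space n closure_of A) \<subseteq> Euclidean_space m closure_of (proj m ` A)"
proof (rule continuous_map_image_closure_subset)
  show "continuous_map (Euclidean_space n) (Euclidean_space m) (proj m)"
    unfolding proj_def continuous_map_componentwise_Euclidean_space
    by (auto simp: Euclidean_space_def
        intro!: continuous_map_from_subtopology continuous_map_product_projection)
qed

lemma cylindrical_cell_subset: "cylindrical_cell js C \<Longrightarrow> C \<subseteq> RR (length js)"
  by (induction rule: cylindrical_cell.induct) (auto simp: RR_eq graph_over_def)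

text \<open>
  The projection of a cell is its base, because the fibre over each point of the base is nonempty:
  it is a single point or a nonempty open interval.
\<close>

lemma is_cell_proj:
  assumes "is_cell (Suc m) C" "m \<ge> 1"
  shows "is_cell m (proj m ` C)"
proof -
  obtain js where js: "length js = Suc m" "cylindrical_cell js C"
    using assms(1) by (auto simp: is_cell_def)
  have base: "is_cell m (proj m ` {x(m := t) | x t. x \<in> B \<and> P x t})"
    if "cylindrical_cell ks B" "length ks = m" and fibre: "\<forall>x\<in>B. \<exists>t. P x t" for ks B P
  proof -
    have sub: "B \<subseteq> RR m" using cylindrical_cell_subset[OF that(1)] that(2) by simp
    have "proj m ` {x(m := t) | x t. x \<in> B \<and> P x t} = B"
    proof (intro equalityI subsetI)
      fix y assume "y \<in> proj m ` {x(m := t) | x t. x \<in> B \<and> P x t}"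
      then show "y \<in> B" using sub proj_update by auto
    next
      fix x assume x: "x \<in> B"
      then obtain t where "P x t" using fibre by blast
      moreover have "x = proj m (x(m := t))" using sub x proj_update by fastforce
      ultimately show "x \<in> proj m ` {x(m := t) | x t. x \<in> B \<and> P x t}" using x by blast
    qed
    then show ?thesis using that unfolding is_cell_def by auto
  qed
  from js(2) show ?thesis
  proof cases
    case (section_cell ks B n f)
    then have "length ks = m" "n = m" using js(1) by simp_all
    moreover have "\<forall>x\<in>B. \<exists>t. t = f x"
      by blast
    ultimately show ?thesis
      using base[OF section_cell(3), of "\<lambda>x t. t = f x"] section_cell(2) by (simp add: graph_over_def)
  next
    case (sector ks B n f g)
    then have "length ks = m" "n = m" using js(1) by simp_all
    moreover have "\<forall>x\<in>B. \<exists>t. f x < t \<and> t < g x"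
      using sector(8) by (intro ballI dense) blast
    ultimately show ?thesis
      using base[OF sector(3), of "\<lambda>x t. f x < t \<and> t < g x"] sector(2) by simp
  next
    case (sector_above ks B n f)
    then have "length ks = m" "n = m" using js(1) by simp_all
    moreover have "\<forall>x\<in>B. \<exists>t. f x < t"
      by (intro ballI gt_ex)
    ultimately show ?thesis
      using base[OF sector_above(3), of "\<lambda>x t. f x < t"] sector_above(2) by simp
  next
    case (sector_below ks B n g)
    then have "length ks = m" "n = m" using js(1) by simp_all
    moreover have "\<forall>x\<in>B. \<exists>t. t < g x"
      by (intro ballI lt_ex)
    ultimately show ?thesis
      using base[OF sector_below(3), of "\<lambda>x t. t < g x"] sector_below(2) by simp
  next
    case (cylinder ks B n)
    then have "length ks = m" "n = m" using js(1) by simp_all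
    moreover have "\<forall>x\<in>B. \<exists>t. True"
      by blast
    ultimately show ?thesis
      using base[OF cylinder(3), of "\<lambda>x t. True"] cylinder(2) by simp
  qed (use assms(2) js(1) in simp_all)
qed

lemma cylindrical_decomposition_partition:
  "cylindrical_decomposition n D \<Longrightarrow> partition_on (RR n) D"
  by (cases n) (auto simp: partition_on_def disjoint_def RR_eq)

lemma partition_on_cell_unique:
  assumes "partition_on X D" "A \<in> D" "B \<in> D" "x \<in> A" "x \<in> B"
  shows "A = B"
  using assms by (auto simp: partition_on_def disjoint_def)

lemma proj_in_induced_step:
  assumes "cylindrical_decomposition (Suc m) D" "m \<ge> 1" "C \<in> D"
  shows "proj m ` C \<in> induced_step m D"
  using assms is_cell_proj by (auto simp: induced_step_def)

lemma cell_through_point_over: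
  assumes D: "cylindrical_decomposition (Suc m) D" and m: "m \<ge> 1"
    and A: "A \<in> induced_step m D" "proj m x \<in> A" and x: "x \<in> RR (Suc m)"
  obtains C where "C \<in> D" "x \<in> C" "proj m ` C = A"
proof -
  have part: "partition_on (RR m) (induced_step m D)"
    using D cylindrical_decomposition_partition by simp
  obtain C where C: "C \<in> D" "x \<in> C"
    using x partition_onD1[OF cylindrical_decomposition_partition[OF D]] by blast
  have "proj m ` C = A"
    using partition_on_cell_unique[OF part proj_in_induced_step[OF D m C(1)] A(1) imageI[OF C(2)] A(2)] .
  with C that show thesis by blast
qed

lemma induced_step_compatible:
  assumes D: "cylindrical_decomposition (Suc m) D" and m: "m \<ge> 1"
    and S: "S \<subseteq> RR (Suc m)" and comp: "compatible D S"
  shows "compatible (induced_step m D) (proj m ` S)"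
  unfolding compatible_def
proof (intro ballI disjCI)
  fix C' assume C': "C' \<in> induced_step m D" and "C' \<inter> proj m ` S \<noteq> {}"
  then obtain s where s: "s \<in> S" "proj m s \<in> C'" by auto
  then obtain C where C: "C \<in> D" "s \<in> C" "proj m ` C = C'"
    using cell_through_point_over[OF D m C'] S by blast
  then have "C \<subseteq> S" using comp s by (auto simp: compatible_def)
  with C(3) show "C' \<subseteq> proj m ` S" by blast
qed

text \<open>
  The heart of the matter: closeness of two cells of \<open>\<real>\<^sup>m\<close> is witnessed by closeness of two cells
  of \<open>\<real>\<^sup>m\<^sup>+\<^sup>1\<close> over them, because one of the finitely many cells that meet the zero section over \<open>C'\<close>
  must accumulate at the point of the zero section over \<open>x\<close>.
\<close>

lemma induced_step_closure:
  assumes D: "cylindrical_decomposition (Suc m) D" and m: "m \<ge> 1"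
    and front: "frontier_condition (Suc m) D"
    and B': "B' \<in> induced_step m D" and C': "C' \<in> induced_step m D"
    and x: "x \<in> B'" "x \<in> Euclidean_space m closure_of C'" "x \<notin> C'"
  shows "B' \<subseteq> Euclidean_space m closure_of C'"
proof -
  let ?cl = "\<lambda>k A. Euclidean_space k closure_of A"
  have part: "partition_on (RR (Suc m)) D" and part': "partition_on (RR m) (induced_step m D)"
    using D cylindrical_decomposition_partition by auto
  (* A point y of the m-dimensional space is, literally, also the point (y, 0) one dimension up. *)
  have over: "\<exists>C\<in>D. y \<in> C \<and> proj m ` C = A" if A: "A \<in> induced_step m D" and y: "y \<in> A" for A y
  proof -
    have "y \<in> RR m" using A y partition_onD1[OF part'] by blast
    then have "proj m y \<in> A" "y \<in> RR (Suc m)"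
      using y proj_id[of y m] by (auto intro: RR_mono)
    then show ?thesis by (rule cell_through_point_over[OF D m A]) blast
  qed
  define F where "F = {C \<in> D. proj m ` C = C'}"
  have "C' \<subseteq> \<Union>F"
    using over[OF C'] unfolding F_def by blast
  then have "?cl (Suc m) C' \<subseteq> ?cl (Suc m) (\<Union>F)" by (rule closure_of_mono)
  with x(2) have "x \<in> ?cl (Suc m) (\<Union>F)"
    using closure_of_Euclidean_space_mono[of m "Suc m" C'] by auto
  moreover have "finite F" using D by (simp add: F_def)
  ultimately obtain C where C: "C \<in> D" "proj m ` C = C'" "x \<in> ?cl (Suc m) C"
    by (auto simp: closure_of_Union F_def)
  obtain B where B: "B \<in> D" "x \<in> B" "proj m ` B = B'"
    using over[OF B' x(1)] by blast
  have "x \<notin> C"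
    using partition_on_cell_unique[OF part B(1) C(1) B(2)] B(3) C(2) x by blast
  obtain E where "E \<subseteq> D" "?cl (Suc m) C - C = \<Union>E"
    using front C(1) unfolding frontier_condition_def by blast
  with \<open>x \<notin> C\<close> C(3) obtain A where "A \<in> D" "x \<in> A" "A \<subseteq> ?cl (Suc m) C"
    by blast
  then have "B \<subseteq> ?cl (Suc m) C"
    using partition_on_cell_unique[OF part B(1) _ B(2)] by blast
  then show ?thesis
    using proj_closure_of_subset[of m "Suc m" C] unfolding B(3)[symmetric] C(2) by blast
qed

lemma induced_step_frontier_condition:
  assumes D: "cylindrical_decomposition (Suc m) D" and m: "m \<ge> 1"
    and front: "frontier_condition (Suc m) D"
  shows "frontier_condition m (induced_step m D)"
  unfolding frontier_condition_def
proof
  fix C' assume C': "C' \<in> induced_step m D"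
  define X where "X = Euclidean_space m closure_of C' - C'"
  have part: "partition_on (RR m) (induced_step m D)"
    using D cylindrical_decomposition_partition by simp
  have "X \<subseteq> \<Union>(induced_step m D)"
    using closure_of_subset_topspace[of "Euclidean_space m" C'] partition_onD1[OF part]
    unfolding X_def by blast
  moreover have "B' \<subseteq> X" if B': "B' \<in> induced_step m D" and x: "x \<in> B'" "x \<in> X" for B' x
  proof -
    have x': "x \<in> Euclidean_space m closure_of C'" "x \<notin> C'"
      using x(2) by (simp_all add: X_def)
    have "y \<notin> C'" if "y \<in> B'" for y
      using partition_on_cell_unique[OF part B' C' that] x(1) x'(2) by metis
    then show ?thesis
      using induced_step_closure[OF D m front B' C' x(1) x'] unfolding X_def by auto
  qed
  ultimately have "\<exists>E\<subseteq>induced_step m D. X = \<Union>E"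
    by (intro exI[of _ "{B' \<in> induced_step m D. B' \<inter> X \<noteq> {}}"]) blast
  then show "\<exists>E\<subseteq>induced_step m D. Euclidean_space m closure_of C' - C' = \<Union>E"
    unfolding X_def .
qed

lemma semialgebraic_subset: "semialgebraic n S \<Longrightarrow> S \<subseteq> RR n"
  by (induction rule: semialgebraic.induct) auto

text \<open>
  The set \<open>S\<close> ranges over all subsets of \<open>\<real>\<^sup>n\<close> so that the induction hypothesis applies at once
  to its projection.
\<close>

lemma induced_decomposition_properties:
  assumes "cylindrical_decomposition n D" "S \<subseteq> RR n" "compatible D S" "frontier_condition n D"
    and "1 \<le> k" "k < n"
  shows "cylindrical_decomposition k (induced_decomposition k n D) \<and>
    compatible (induced_decomposition k n D) (proj k ` S) \<and>
    frontier_condition k (induced_decomposition k n D)"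
  using assms
proof (induction n arbitrary: D S)
  case (Suc m)
  then have m: "m \<ge> 1" by simp
  define D' where "D' = induced_step m D"
  have D': "cylindrical_decomposition m D'" "compatible D' (proj m ` S)" "frontier_condition m D'"
    using Suc.prems induced_step_compatible[OF _ m] induced_step_frontier_condition[OF _ m]
    unfolding D'_def by auto
  have step: "induced_decomposition k (Suc m) D = induced_decomposition k m D'"
    using Suc.prems by (simp add: D'_def)
  show ?case
  proof (cases "k = m")
    case True
    then have "induced_decomposition k m D' = D'" using m by (cases m) auto
    with D' step True show ?thesis by simp
  next
    case False
    then have "k < m" using Suc.prems by simp
    with Suc.IH[OF D'(1) _ D'(2,3)] Suc.prems(5) show ?thesis
      using proj_in_RR proj_image_proj[of k m S] unfolding step by auto
  qed
qed simp

theorem theorem2: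
  fixes n :: nat and D :: "(nat \<Rightarrow> real) set set" and S :: "(nat \<Rightarrow> real) set"
  assumes "cylindrical_decomposition n D"
    and "semialgebraic n S"
    and "compatible D S"
    and "frontier_condition n D"
  shows "\<forall>k. 1 \<le> k \<and> k < n \<longrightarrow>
    cylindrical_decomposition k (induced_decomposition k n D) \<and>
    compatible (induced_decomposition k n D) (proj k ` S) \<and>
    frontier_condition k (induced_decomposition k n D)"
  using induced_decomposition_properties[OF assms(1) semialgebraic_subset[OF assms(2)] assms(3,4)]
  by blast

end
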